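(* Let $n>2$ and $m$ be positive integers with $n\notin\mathcal{E}$ and $n\mid m$. Write $n=2^s p_1^{r_1}\cdots p_k^{r_k}$ with $s\ge 0$, $k\ge 0$, $p_1,\dots,p_k$ distinct odd primes and $r_i\ge 1$. Then $$\varrho(n)=\frac{\varphi(n)}{2^{\omega(n)}}=\begin{cases}\displaystyle\prod_{i=1}^k\bigl|\mathrm{QR}^{*}(\mathbb{Z}/p_i^{r_i}\mathbb{Z})\bigr| & \text{if } s=0,\\[6pt] \displaystyle\frac12\prod_{i=1}^k\bigl|\mathrm{QR}^{*}(\mathbb{Z}/p_i^{r_i}\mathbb{Z})\bigr| & \text{if } s=1,\\[6pt] \displaystyle 2^{s-2}\prod_{i=1}^k\bigl|\mathrm{QR}^{*}(\mathbb{Z}/p_i^{r_i}\mathbb{Z})\bigr| & \text{if } s\ge 2.\end{cases}$$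
   Context: $\varphi$ is Euler's totient function, $\omega(n)$ is the number of distinct prime divisors of $n$, and $\varrho(n):=\varphi(n)/2^{\omega(n)}$ (a rational number). The exception set $\mathcal{E}$ is the set of all integers $n>2$ of the form $n=2\alpha$, where $\alpha$ is a positive odd integer such that every prime $p\mid\alpha$ satisfies $p\equiv 3\pmod 4$. For an odd prime $p$ and $r\ge 1$, $\mathrm{QR}^{*}(\mathbb{Z}/p^r\mathbb{Z}):=\{x\in(\mathbb{Z}/p^r\mathbb{Z})^*: x\equiv y^2\pmod{p^r}\text{ for some }y\}$. Empty products equal $1$. *)

theory Defs
  imports "HOL-Number_Theory.Number_Theory"
begin

definition omega :: "nat \<Rightarrow> nat" where
  "omega n = card (prime_factors n)"

definition varrho :: "nat \<Rightarrow> rat" where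
  "varrho n = of_nat (totient n) / 2 ^ omega n"

definition exception_set :: "nat set" where
  "exception_set = {n. n > 2 \<and> (\<exists>\<alpha>. n = 2 * \<alpha> \<and> \<alpha> > 0 \<and> odd \<alpha> \<and>
     (\<forall>p. prime p \<longrightarrow> p dvd \<alpha> \<longrightarrow> [p = 3] (mod 4)))}"

(* The ring of integers modulo q has carrier {0..q - 1}, so each residue class is counted
   exactly once. QuadRes q x says that x is congruent to some square modulo q; q need not be
   prime. *)
definition QR_star :: "nat \<Rightarrow> int set" where
  "QR_star q = {x \<in> Units (residue_ring (int q)). QuadRes (int q) x}"

end

theory Submission
  imports Defs
begin

text \<open>
  Both \<open>totient\<close> and \<open>2 ^ omega\<close> are multiplicative over coprime factors, hence so is their
  quotient \<open>varrho\<close>, and everything reduces to prime powers. For \<open>q = p ^ r\<close> with \<open>p\<close> an odd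
  prime, squaring is exactly two-to-one on the units modulo \<open>q\<close>: from \<open>q\<close> dividing
  \<open>(x - y) * (x + y)\<close> it follows that \<open>q\<close> divides one of the two factors, because \<open>p\<close> cannot
  divide both of them without dividing \<open>2 * x\<close>. The unit squares are the image of this map, so
  they number \<open>totient q / 2\<close>, and this is \<open>varrho q\<close> because \<open>omega q = 1\<close>. The factor that
  depends on \<open>s\<close> is the value of \<open>varrho\<close> at \<open>2 ^ s\<close>, namely \<open>1\<close>, \<open>1 / 2\<close> or \<open>2 ^ (s - 2)\<close>.
\<close>

text \<open>
  One of \<open>x - y\<close> and \<open>x + y\<close> is coprime to \<open>p\<close>, so the other one absorbs the whole power
  \<open>p ^ r\<close>. Oddness of the prime is essential: modulo \<open>2 ^ r\<close> with \<open>r \<ge> 3\<close>, the number \<open>1\<close> has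
  four square roots.
\<close>

lemma cong_square_odd_prime_power_imp:
  fixes x y :: int and p r :: nat
  assumes p: "prime p" "odd p"
    and x: "\<not> int p dvd x"
    and sq: "[x\<^sup>2 = y\<^sup>2] (mod int (p ^ r))"
  shows "[x = y] (mod int (p ^ r)) \<or> [x = - y] (mod int (p ^ r))"
proof -
  have dvd: "int p ^ r dvd (x - y) * (x + y)"
    using sq by (simp add: cong_iff_dvd_diff power2_eq_square algebra_simps)
  have pr: "prime (int p)"
    using p by simp
  have "\<not> (int p dvd x - y \<and> int p dvd x + y)"
  proof
    assume "int p dvd x - y \<and> int p dvd x + y"
    then have "int p dvd (x - y) + (x + y)"
      using dvd_add by blast
    then have "int p dvd 2 * x"
      by simp
    with x pr have "int p dvd 2"
      using prime_dvd_mult_iff by blast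
    then have "p dvd 2"
      by presburger
    with p show False
      by (metis primes_dvd_imp_eq two_is_prime_nat dvd_refl)
  qed
  then have "coprime (int p ^ r) (x - y) \<or> coprime (int p ^ r) (x + y)"
    using prime_imp_coprime[OF pr] by auto
  then have "int p ^ r dvd x + y \<or> int p ^ r dvd x - y"
    using dvd coprime_dvd_mult_right_iff coprime_dvd_mult_left_iff by blast
  then show ?thesis
    by (auto simp: cong_iff_dvd_diff)
qed

text \<open>
  The units modulo \<open>q = p ^ r\<close> are counted by the fibres of the squaring map. Representing
  residues by integers in \<open>{0<..<q}\<close>, the fibre of \<open>x\<close> is \<open>{x, q - x}\<close>, and these two
  integers differ because \<open>q\<close> is odd.
\<close>

lemma card_QR_star_odd_prime_power:
  fixes p r :: nat
  assumes p: "prime p" "odd p" and r: "r \<ge> 1"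
  shows "2 * card (QR_star (p ^ r)) = totient (p ^ r)"
proof -
  define q where "q = int (p ^ r)"
  have p1: "p > 1"
    using p(1) by (rule prime_gt_1_nat)
  have pr1: "p ^ r > 1"
    using p1 r by (intro one_less_power) auto
  then have q1: "q > 1"
    unfolding q_def by linarith
  have odd_q: "odd q"
    using p by (simp add: q_def)
  interpret residues q "residue_ring q"
    using q1 by (simp_all add: residues_def)
  define U where "U = Units (residue_ring q)"
  have U: "U = {x. 0 < x \<and> x < q \<and> coprime x q}"
    unfolding U_def by (rule res_units_eq)
  have fin: "finite U"
    by (simp add: U_def)
  define f where "f = (\<lambda>x::int. x\<^sup>2 mod q)"
  have f_unit: "f x \<in> U" if "x \<in> U" for x
    using that q1 unfolding f_def U_def by (intro mod_in_res_units) (auto simp: res_units_eq)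
  have image: "QR_star (p ^ r) = f ` U"
  proof (intro equalityI subsetI)
    fix z assume "z \<in> QR_star (p ^ r)"
    then obtain y where z: "z \<in> U" and y: "[y\<^sup>2 = z] (mod q)"
      by (auto simp: QR_star_def QuadRes_def q_def U_def)
    \<comment> \<open>A root of a unit is itself a unit, so restricting squaring to units loses no squares.\<close>
    have "coprime (y\<^sup>2) q"
      using z y cong_imp_coprime[OF cong_sym[OF y]] by (simp add: U)
    then have "y mod q \<in> U"
      unfolding U_def using q1 by (intro mod_in_res_units) auto
    moreover have "f (y mod q) = z"
      using y z by (simp add: f_def U power_mod cong_def)
    ultimately show "z \<in> f ` U"
      by blast
  next
    fix z assume "z \<in> f ` U"
    then obtain x where x: "x \<in> U" "z = f x"
      by auto
    have "[x\<^sup>2 = z] (mod q)"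
      by (simp add: x f_def cong_def)
    then show "z \<in> QR_star (p ^ r)"
      using f_unit[OF x(1)] x by (auto simp: QR_star_def QuadRes_def q_def U_def)
  qed
  have fibre: "card {y \<in> U. f y = z} = 2" if "z \<in> f ` U" for z
  proof -
    from that obtain x where x: "x \<in> U" "z = f x"
      by blast
    have ndvd: "\<not> int p dvd x"
    proof
      assume "int p dvd x"
      moreover have "int p dvd q"
        using r by (simp add: q_def dvd_power)
      ultimately have "is_unit (int p)"
        using x coprime_common_divisor unfolding U by blast
      with p1 show False
        by simp
    qed
    have "{y \<in> U. f y = z} = {x, q - x}"
    proof (intro equalityI subsetI)
      fix y assume "y \<in> {y \<in> U. f y = z}"
      then have y: "y \<in> U" and "[x\<^sup>2 = y\<^sup>2] (mod q)"
        using x by (auto simp: f_def cong_def)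
      then have "[x = y] (mod q) \<or> [x = - y] (mod q)"
        using cong_square_odd_prime_power_imp[OF p ndvd] by (simp add: q_def)
      then show "y \<in> {x, q - x}"
      proof
        assume "[x = y] (mod q)"
        then show ?thesis
          using x y by (simp add: U cong_def)
      next
        assume "[x = - y] (mod q)"
        then have "[x = q - y] (mod q)"
          by (simp add: cong_def)
        then have "x = q - y"
          using x y by (intro cong_less_imp_eq_int) (auto simp: U)
        then show ?thesis
          by simp
      qed
    next
      fix y assume "y \<in> {x, q - x}"
      moreover have "coprime (q - x) q"
        using x gcd_diff2[of q x] by (simp add: U flip: coprime_iff_gcd_eq_1)
      moreover have "f (q - x) = f x"
      proof -
        have "(q - x)\<^sup>2 = x\<^sup>2 + q * (q - 2 * x)"
          by (simp add: power2_eq_square algebra_simps)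
        then show ?thesis
          by (simp add: f_def)
      qed
      ultimately show "y \<in> {y \<in> U. f y = z}"
        using x by (auto simp: U)
    qed
    moreover have "x \<noteq> q - x"
      using odd_q by presburger
    ultimately show ?thesis
      by simp
  qed
  have "card U = 2 * card (QR_star (p ^ r))"
  proof -
    have "card U = (\<Sum>z\<in>f ` U. card {y \<in> U. f y = z})"
      using sum.image_gen[OF fin, of "\<lambda>_. 1 :: nat" f] by simp
    also have "\<dots> = 2 * card (f ` U)"
      using fibre by simp
    finally show ?thesis
      using image by simp
  qed
  moreover have "card U = totient (p ^ r)"
  proof -
    have "U = int ` totatives (p ^ r)"
    proof (intro equalityI subsetI)
      fix x assume "x \<in> U"
      moreover from this obtain y where "x = int y"
        using zero_less_imp_eq_int[of x] by (auto simp: U)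
      ultimately show "x \<in> int ` totatives (p ^ r)"
        by (auto simp: U in_totatives_iff q_def simp del: of_nat_power)
    next
      fix x assume "x \<in> int ` totatives (p ^ r)"
      then obtain y where y: "y \<in> totatives (p ^ r)" "x = int y"
        by blast
      have "y < p ^ r"
        using y(1) pr1 by (rule totatives_less)
      then show "x \<in> U"
        using y by (auto simp: U q_def in_totatives_iff simp del: of_nat_power)
    qed
    then show ?thesis
      by (simp add: card_image totient_def)
  qed
  ultimately show ?thesis
    by simp
qed

lemma omega_mult_coprime:
  assumes "coprime a b" "a > 0" "b > 0"
  shows "omega (a * b) = omega a + omega b"
proof -
  have "prime_factors a \<inter> prime_factors b = {}"
    using assms(1) by (auto simp: in_prime_factors_iff dest: coprime_common_divisor_nat)
  then show ?thesis
    using assms by (simp add: omega_def prime_factors_product card_Un_disjoint)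
qed

lemma varrho_mult_coprime:
  assumes "coprime a b" "a > 0" "b > 0"
  shows "varrho (a * b) = varrho a * varrho b"
  using assms by (simp add: varrho_def omega_mult_coprime totient_mult_coprime power_add)

lemma varrho_1: "varrho 1 = 1"
  by (simp add: varrho_def omega_def)

lemma varrho_prod_coprime:
  assumes "finite A"
    and "\<And>a. a \<in> A \<Longrightarrow> f a > 0"
    and "\<And>a b. a \<in> A \<Longrightarrow> b \<in> A \<Longrightarrow> a \<noteq> b \<Longrightarrow> coprime (f a) (f b)"
  shows "varrho (\<Prod>a\<in>A. f a) = (\<Prod>a\<in>A. varrho (f a))"
  using assms
proof (induction A rule: finite_induct)
  case empty
  show ?case
    using varrho_1 by simp
next
  case (insert x A)
  have "coprime (f x) (\<Prod>a\<in>A. f a)"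
    using insert.hyps insert.prems by (intro prod_coprime_right) auto
  moreover have "(\<Prod>a\<in>A. f a) > 0"
    using insert.prems by (intro prod_pos) auto
  ultimately show ?case
    using insert by (simp add: varrho_mult_coprime)
qed

lemma omega_prime_power:
  assumes "prime p" "r \<ge> 1"
  shows "omega (p ^ r) = 1"
  using assms by (simp add: omega_def prime_factors_power prime_prime_factors)

lemma varrho_odd_prime_power:
  assumes "prime p" "odd p" "r \<ge> 1"
  shows "varrho (p ^ r) = of_nat (card (QR_star (p ^ r)))"
  using assms
  by (simp add: varrho_def omega_prime_power flip: card_QR_star_odd_prime_power)

lemma varrho_two_power:
  "varrho (2 ^ s) = (if s = 0 then 1 else if s = 1 then 1 / 2 else 2 ^ (s - 2))"
proof (cases "s \<ge> 2")
  case True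
  then have "totient (2 ^ s) = 2 ^ (s - 1)"
    by (simp add: totient_prime_power)
  moreover have "s - 1 = Suc (s - 2)"
    using True by simp
  ultimately show ?thesis
    using True by (simp add: varrho_def omega_prime_power)
next
  case False
  then consider "s = 0" | "s = 1"
    by linarith
  then show ?thesis
    using omega_prime_power[of 2 1] varrho_1 by cases (simp_all add: varrho_def)
qed

theorem theorem4p1:
  fixes n m s k :: nat and p r :: "nat \<Rightarrow> nat"
  assumes "n > 2" and "m > 0"
    and "n \<notin> exception_set"
    and "n dvd m"
    and "n = 2 ^ s * (\<Prod>i=1..k. p i ^ r i)"
    and "inj_on p {1..k}"
    and "\<And>i. i \<in> {1..k} \<Longrightarrow> prime (p i) \<and> odd (p i)"
    and "\<And>i. i \<in> {1..k} \<Longrightarrow> r i \<ge> 1"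
  shows "varrho n = of_nat (totient n) / 2 ^ omega n \<and>
    varrho n =
      (if s = 0 then (\<Prod>i=1..k. of_nat (card (QR_star (p i ^ r i))))
       else if s = 1 then 1 / 2 * (\<Prod>i=1..k. of_nat (card (QR_star (p i ^ r i))))
       else 2 ^ (s - 2) * (\<Prod>i=1..k. of_nat (card (QR_star (p i ^ r i)))))"
proof -
  let ?a = "\<Prod>i=1..k. p i ^ r i"
  have pos: "p i ^ r i > 0" if "i \<in> {1..k}" for i
    using assms(7)[OF that] by (simp add: prime_gt_0_nat)
  have coprime: "coprime (p i ^ r i) (p j ^ r j)"
    if "i \<in> {1..k}" "j \<in> {1..k}" "i \<noteq> j" for i j
  proof -
    have "p i \<noteq> p j"
      using that assms(6) by (auto dest: inj_onD)
    then show ?thesis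
      using assms(7) that by (simp add: primes_coprime)
  qed
  have "odd ?a"
    using assms(7) by (subst even_prod_iff) auto
  then have "coprime (2 ^ s) ?a"
    by simp
  moreover have "?a > 0"
    using pos by (intro prod_pos) auto
  ultimately have "varrho n = varrho (2 ^ s) * varrho ?a"
    by (simp add: assms(5) varrho_mult_coprime)
  also have "varrho ?a = (\<Prod>i=1..k. varrho (p i ^ r i))"
    using pos coprime by (intro varrho_prod_coprime) auto
  also have "\<dots> = (\<Prod>i=1..k. of_nat (card (QR_star (p i ^ r i))))"
    using assms(7,8) by (intro prod.cong) (auto simp: varrho_odd_prime_power)
  finally show ?thesis
    by (simp add: varrho_def[of n] varrho_two_power)
qed

end
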